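(* For all integers $n\ge k\ge 4$, the graph $G_n^k$ is edge pancyclic; that is, every edge of $G_n^k$ lies on a cycle of length $\ell$ for every integer $\ell$ with $3\le \ell\le n!/(n-k)!$.
   Context: For integers $n\ge k$, let $[n]=\{1,\ldots,n\}$ and let $A_{[n]}^k$ denote the set of ordered $k$-tuples of pairwise distinct elements of $[n]$, so $|A_{[n]}^k|=n!/(n-k)!$. The graph $G_n^k$ has vertex set $A_{[n]}^k$, and two vertices $a=(a_1,\dots,a_k)$ and $b=(b_1,\dots,b_k)$ are adjacent if and only if $a_i\ne b_i$ for all $i=1,\dots,k$. A graph of order $N\ge 3$ is edge pancyclic if every edge lies on a cycle of each length from $3$ to $N$. *)

theory Defs
  imports Complex_Main "Graph_Theory.Pair_Digraph"
begin

text \<open>Tuples are lists; the list index \<open>i < k\<close> is the coordinate \<open>i + 1\<close> of the tuple.\<close>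

definition arrangements :: "nat \<Rightarrow> nat \<Rightarrow> nat list set" where
  "arrangements n k = {a. length a = k \<and> distinct a \<and> set a \<subseteq> {1..n}}"

text \<open>Undirected graphs follow the convention of the Graph Theory library: an edge
  \<open>{a, b}\<close> is the pair of opposite arcs \<open>(a, b)\<close> and \<open>(b, a)\<close>.\<close>

definition tuple_derangement_graph :: "nat \<Rightarrow> nat \<Rightarrow> nat list pair_pre_digraph" where
  "tuple_derangement_graph n k =
    \<lparr> pverts = arrangements n k,
      parcs = {(a, b). a \<in> arrangements n k \<and> b \<in> arrangements n k \<and> (\<forall>i<k. a ! i \<noteq> b ! i)} \<rparr>"

text \<open>The library predicate \<open>cycle\<close> also admits the walk \<open>u, v, u\<close>, of length 2, in a symmetric
  digraph. For length at least 3 it describes exactly the cycles of the undirected graph, each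
  with a starting vertex and a direction of traversal.\<close>

definition edge_on_cycle_of_length :: "'a pair_pre_digraph \<Rightarrow> 'a \<Rightarrow> 'a \<Rightarrow> nat \<Rightarrow> bool" where
  "edge_on_cycle_of_length G u v l \<longleftrightarrow>
    (\<exists>p. pre_digraph.cycle (with_proj G) p \<and> length p = l \<and> ((u, v) \<in> set p \<or> (v, u) \<in> set p))"

definition edge_pancyclic :: "'a pair_pre_digraph \<Rightarrow> bool" where
  "edge_pancyclic G \<longleftrightarrow> pair_graph G \<and> 3 \<le> card (pverts G) \<and>
    (\<forall>u v l. (u, v) \<in> parcs G \<longrightarrow> 3 \<le> l \<longrightarrow> l \<le> card (pverts G) \<longrightarrow>
      edge_on_cycle_of_length G u v l)"

lemma finite_arrangements: "finite (arrangements n k)"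
  unfolding arrangements_def
  by (rule finite_subset[OF _ finite_lists_length_eq[of "{1..n}" k]]) auto

lemma card_arrangements:
  assumes "k \<le> n"
  shows "card (arrangements n k) = fact n div fact (n - k)"
proof -
  have "card (arrangements n k) = \<Prod>{card {1..n} - k + 1..card {1..n}}"
    unfolding arrangements_def using assms by (intro card_lists_distinct_length_eq) auto
  then show ?thesis
    using assms by (simp add: fact_div_fact)
qed

lemma pair_graph_tuple_derangement_graph:
  assumes "0 < k"
  shows "pair_graph (tuple_derangement_graph n k)"
proof
  show "finite (parcs (tuple_derangement_graph n k))"
    by (rule finite_subset[of _ "arrangements n k \<times> arrangements n k"])
      (auto simp: tuple_derangement_graph_def finite_arrangements)
  show "symmetric (with_proj (tuple_derangement_graph n k))"
    unfolding symmetric_def sym_def by (auto simp: tuple_derangement_graph_def)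
qed (use assms in \<open>auto simp: tuple_derangement_graph_def finite_arrangements\<close>)

end

theory Submission
  imports Defs "HOL-Combinatorics.Transposition" "HOL-Number_Theory.Cong"
begin

text \<open>Adding a constant modulo \<open>n\<close> to all entries of a tuple partitions the vertices into cliques of
  size \<open>n\<close>, each with a unique representative starting with \<open>n\<close>. Exchanging two consecutive values
  \<open>v, v + 1\<close> with \<open>1 \<le> v \<le> n - 2\<close> in a representative leads to another clique, and the two cliques
  are joined by a perfect matching. So every clique has at most \<open>n - 2\<close> such neighbours, and
  consecutive swaps connect all cliques.

  A cycle through the edge \<open>ab\<close>, recorded as a path from \<open>b\<close> to \<open>a\<close> so that \<open>ab\<close> itself is never
  touched, is grown clique by clique: an edge of the path inside an absorbed clique is replaced by
  a detour through 2 to \<open>n\<close> vertices of a new neighbouring clique. The bound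
  \<open>n - 2\<close> on the number of neighbours guarantees that an edge is always left to start the next detour.
  Only triangles need a separate argument: a common neighbour of \<open>a\<close> and \<open>b\<close> is found by removing
  conflicts from a tuple one at a time by value transpositions.\<close>

section \<open>Cycles in graphs partitioned into cliques\<close>

definition path_between :: "('v \<Rightarrow> 'v \<Rightarrow> bool) \<Rightarrow> 'v set \<Rightarrow> 'v \<Rightarrow> 'v \<Rightarrow> 'v list \<Rightarrow> bool" where
  "path_between E U x y xs \<longleftrightarrow>
    xs \<noteq> [] \<and> distinct xs \<and> set xs \<subseteq> U \<and> successively E xs \<and> hd xs = x \<and> last xs = y"

lemma path_between_mono: "path_between E U x y xs \<Longrightarrow> U \<subseteq> W \<Longrightarrow> path_between E W x y xs"
  by (auto simp: path_between_def)

lemma path_between_append: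
  assumes "path_between E U x y xs" "path_between E W z w ys" "E y z" "U \<inter> W = {}"
  shows "path_between E (U \<union> W) x w (xs @ ys)"
  using assms by (auto simp: path_between_def successively_append_iff)

text \<open>The detour move: as \<open>W\<close> is disjoint from \<open>U\<close>, trading the edge
  from \<open>x\<close> to \<open>y\<close> for a path through \<open>W\<close> repeats no vertex
  and leaves the ends \<open>a\<close>, \<open>b\<close> in place.\<close>

lemma path_between_insert:
  assumes "path_between E U a b (us @ x # y # vs)" "path_between E W x' y' ws"
    "E x x'" "E y' y" "U \<inter> W = {}"
  shows "path_between E (U \<union> W) a b (us @ x # ws @ y # vs)"
  using assms
  by (auto simp: path_between_def successively_append_iff successively_Cons hd_append)

text \<open>For a clique \<open>C\<close> these steps are the places where a detour can still
  start.\<close>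

fun steps_in :: "'v set \<Rightarrow> 'v list \<Rightarrow> nat" where
  "steps_in C (x # y # xs) = (if x \<in> C \<and> y \<in> C then 1 else 0) + steps_in C (y # xs)"
| "steps_in C _ = 0"

text \<open>The cut vertex \<open>x\<close> goes to both halves, so no step is lost at the
  cut.\<close>

lemma steps_in_split: "steps_in C (xs @ x # ys) = steps_in C (xs @ [x]) + steps_in C (x # ys)"
proof (induction xs)
  case (Cons z zs)
  then show ?case by (cases zs) auto
qed simp

lemma steps_in_subset: "set xs \<subseteq> C \<Longrightarrow> steps_in C xs = length xs - 1"
  by (induction C xs rule: steps_in.induct) auto

lemma steps_in_avoid:
  "ws \<noteq> [] \<Longrightarrow> set ws \<inter> C = {} \<Longrightarrow> steps_in C (x # ws @ y # vs) = steps_in C (y # vs)"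
proof (induction ws arbitrary: x)
  case (Cons w ws)
  then show ?case by (cases ws) auto
qed simp

lemma steps_in_le_append:
  "steps_in C ws \<le> steps_in C (us @ ws)" "steps_in C ws \<le> steps_in C (ws @ us)"
proof -
  show "steps_in C ws \<le> steps_in C (us @ ws)"
    by (cases ws) (auto intro: order_trans[OF _ eq_refl[OF steps_in_split[symmetric]]])
  show "steps_in C ws \<le> steps_in C (ws @ us)"
    by (cases ws rule: rev_cases) (auto intro: order_trans[OF _ eq_refl[OF steps_in_split[symmetric]]])
qed

lemma steps_in_posE:
  assumes "0 < steps_in C xs"
  obtains us x y vs where "xs = us @ x # y # vs" "x \<in> C" "y \<in> C"
  using assms
proof (induction C xs arbitrary: thesis rule: steps_in.induct)
  case (1 C x y xs)
  show ?case
  proof (cases "x \<in> C \<and> y \<in> C")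
    case True
    then show ?thesis using "1.prems"(1)[of "[]"] by auto
  next
    case False
    then have "0 < steps_in C (y # xs)"
      using "1.prems"(2) by (simp split: if_splits)
    then obtain us x' y' vs where "y # xs = us @ x' # y' # vs" "x' \<in> C" "y' \<in> C"
      using "1.IH" by blast
    then show ?thesis
      using "1.prems"(1)[of "x # us"] by simp
  qed
qed auto

text \<open>\<open>N i\<close> holds the cliques that a detour from an edge of \<open>C i\<close>
  may enter; \<open>x' \<noteq> y'\<close> in \<open>link\<close> leaves room for paths on 2 to
  \<open>n\<close> vertices of \<open>C j\<close>. A Hamiltonian path of \<open>C i\<close> has
  \<open>n - 1\<close> edges, one more than the bound in \<open>card_N\<close>. Connectivity is
  phrased by closed sets: unless a nonempty \<open>S\<close> is all of \<open>I\<close>, some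
  \<open>N i\<close> with \<open>i \<in> S\<close> leaves \<open>S\<close>.\<close>

locale clique_partition =
  fixes E :: "'v \<Rightarrow> 'v \<Rightarrow> bool" and C :: "'i \<Rightarrow> 'v set" and I :: "'i set"
    and N :: "'i \<Rightarrow> 'i set" and n :: nat
  assumes n_ge: "4 \<le> n"
    and sym: "E x y \<Longrightarrow> E y x"
    and finite_I: "finite I"
    and card_C: "i \<in> I \<Longrightarrow> card (C i) = n"
    and disjoint_C: "i \<in> I \<Longrightarrow> j \<in> I \<Longrightarrow> i \<noteq> j \<Longrightarrow> C i \<inter> C j = {}"
    and clique: "i \<in> I \<Longrightarrow> x \<in> C i \<Longrightarrow> y \<in> C i \<Longrightarrow> x \<noteq> y \<Longrightarrow> E x y"
    and N_subset: "i \<in> I \<Longrightarrow> N i \<subseteq> I"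
    and card_N: "i \<in> I \<Longrightarrow> card (N i) \<le> n - 2"
    and link: "\<And>i j x y. i \<in> I \<Longrightarrow> j \<in> N i \<Longrightarrow> x \<in> C i \<Longrightarrow> y \<in> C i \<Longrightarrow> x \<noteq> y \<Longrightarrow>
      \<exists>x'\<in>C j. \<exists>y'\<in>C j. x' \<noteq> y' \<and> E x x' \<and> E y' y"
    and connected: "\<And>S. S \<subseteq> I \<Longrightarrow> S \<noteq> {} \<Longrightarrow> (\<And>i. i \<in> S \<Longrightarrow> N i \<subseteq> S) \<Longrightarrow> S = I"
begin

section \<open>Growing a path clique by clique\<close>

lemma finite_C: "i \<in> I \<Longrightarrow> finite (C i)"
  using card_C n_ge by (metis card.infinite not_numeral_le_zero)

lemma successively_clique:
  "i \<in> I \<Longrightarrow> distinct xs \<Longrightarrow> set xs \<subseteq> C i \<Longrightarrow> successively E xs"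
  by (induction xs rule: induct_list012) (auto intro: clique)

text \<open>Every list of distinct vertices of a clique is a path, so only \<open>t - 2\<close>
  interior vertices have to be chosen among the \<open>n - 2\<close> available.\<close>

lemma clique_path:
  assumes i: "i \<in> I" "x \<in> C i" "y \<in> C i" "x \<noteq> y" and t: "2 \<le> t" "t \<le> n"
  shows "\<exists>ws. path_between E (C i) x y ws \<and> length ws = t"
proof -
  have "t - 2 \<le> card (C i - {x, y})"
    using i t by (simp add: card_Diff_subset card_C)
  then obtain T where T: "T \<subseteq> C i - {x, y}" "card T = t - 2" "finite T"
    by (meson obtain_subset_with_card_n)
  then obtain ts where ts: "set ts = T" "distinct ts"
    using finite_distinct_list by blast
  let ?ws = "x # ts @ [y]"
  have sub: "set ?ws \<subseteq> C i" and dist: "distinct ?ws"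
    using ts T i by auto
  have "successively E ?ws"
    using successively_clique[OF i(1) dist sub] .
  moreover have "length ?ws = t"
    using ts T t distinct_card[of ts] by simp
  ultimately have "path_between E (C i) x y ?ws \<and> length ?ws = t"
    using sub dist by (simp add: path_between_def)
  then show ?thesis by blast
qed

text \<open>The count in \<open>cnt\<close> is an invariant: the detour into \<open>C j\<close> uses
  up one step of \<open>C i\<close>, and in exchange \<open>j\<close> joins the absorbed neighbours
  of \<open>i\<close>. No other clique of \<open>S\<close> loses a step.\<close>

lemma extend_path:
  assumes S: "S \<subseteq> I" and i: "i \<in> S" and j: "j \<in> N i" "j \<notin> S"
    and xs: "path_between E (\<Union>(C ` S)) b a xs"
    and cnt: "\<And>i. i \<in> S \<Longrightarrow> n - 1 \<le> steps_in (C i) xs + card (S \<inter> N i) + d"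
    and d: "d \<le> 1" and t: "2 \<le> t" "t \<le> n"
  shows "\<exists>zs. path_between E (\<Union>(C ` insert j S)) b a zs \<and> length zs = length xs + t \<and>
    t - 1 \<le> steps_in (C j) zs \<and>
    (\<forall>i\<in>S. n - 1 \<le> steps_in (C i) zs + card (insert j S \<inter> N i) + d)"
proof -
  have iI: "i \<in> I" and jI: "j \<in> I"
    using S i j N_subset by auto
  have finS: "finite S"
    using S finite_I finite_subset by auto
  \<comment> \<open>As \<open>j\<close> lies in \<open>N i\<close> but outside \<open>S\<close>, at
    most \<open>n - 3\<close> neighbours of \<open>i\<close> are absorbed. With
    \<open>d \<le> 1\<close> the invariant leaves at least \<open>(n - 1) - (n - 3) - 1 = 1\<close>
    step in \<open>C i\<close>.\<close>
  have "card (insert j (S \<inter> N i)) \<le> card (N i)"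
    using j N_subset[OF iI] finite_I by (intro card_mono) (auto intro: finite_subset)
  then have "card (S \<inter> N i) \<le> n - 3"
    using j finS card_N[OF iI] by simp
  then have "0 < steps_in (C i) xs"
    using cnt[OF i] d n_ge by linarith
  then obtain us x y vs where split: "xs = us @ x # y # vs" and xy: "x \<in> C i" "y \<in> C i"
    by (rule steps_in_posE)
  have "x \<noteq> y"
    using xs split by (auto simp: path_between_def)
  then obtain x' y' where x'y': "x' \<in> C j" "y' \<in> C j" "x' \<noteq> y'" "E x x'" "E y' y"
    using link[OF iI j(1) xy] by blast
  obtain ws where ws: "path_between E (C j) x' y' ws" "length ws = t"
    using clique_path[OF jI x'y'(1-3) t] by blast
  let ?zs = "us @ x # ws @ y # vs"
  have disj: "C k \<inter> C j = {}" if "k \<in> S" for k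
    using disjoint_C[of k j] that j jI S by auto
  have "path_between E (\<Union>(C ` S) \<union> C j) b a ?zs"
    using disj by (intro path_between_insert[OF xs[unfolded split] ws(1) x'y'(4,5)]) auto
  then have path: "path_between E (\<Union>(C ` insert j S)) b a ?zs"
    by (simp add: Un_commute)
  have "t - 1 = steps_in (C j) ws"
    using ws by (subst steps_in_subset) (auto simp: path_between_def)
  also have "\<dots> \<le> steps_in (C j) (ws @ y # vs)"
    by (rule steps_in_le_append)
  also have "\<dots> \<le> steps_in (C j) ((us @ [x]) @ ws @ y # vs)"
    by (rule steps_in_le_append)
  finally have new: "t - 1 \<le> steps_in (C j) ?zs" by simp
  have "n - 1 \<le> steps_in (C k) ?zs + card (insert j S \<inter> N k) + d" if k: "k \<in> S" for k
  proof -
    have "steps_in (C k) (x # ws @ y # vs) = steps_in (C k) (y # vs)"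
      using ws disj[OF k] t by (intro steps_in_avoid) (auto simp: path_between_def)
    \<comment> \<open>Both paths contain \<open>us @ [x]\<close> and \<open>y # vs\<close>, so for
      \<open>C k\<close> they differ at most in the step from \<open>x\<close> to
      \<open>y\<close>.\<close>
    then have eq: "steps_in (C k) xs = steps_in (C k) ?zs + (if x \<in> C k \<and> y \<in> C k then 1 else 0)"
      using steps_in_split[of "C k" us x "y # vs"] steps_in_split[of "C k" us x "ws @ y # vs"] split
      by simp
    show ?thesis
    proof (cases "k = i")
      case True
      have "insert j S \<inter> N i = insert j (S \<inter> N i)"
        using j by auto
      then have "card (insert j S \<inter> N i) = Suc (card (S \<inter> N i))"
        using j finS by simp
      then show ?thesis
        using True eq cnt[OF k] xy by simp
    next
      case False
      then have "x \<notin> C k"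
        using disjoint_C[of k i] k iI S xy by auto
      moreover have "card (S \<inter> N k) \<le> card (insert j S \<inter> N k)"
        using finS by (intro card_mono) auto
      ultimately show ?thesis
        using eq cnt[OF k] by simp
    qed
  qed
  then show ?thesis
    using path new ws(2) split by (intro exI[of _ ?zs]) auto
qed

text \<open>A clique absorbed in full contributes a path with \<open>n - 1\<close> steps, and each absorbed neighbour used
  up at most one of them. The deficit \<open>d\<close> is 0 or 1; a path that misses one vertex is needed since
  detours through 2 to \<open>n\<close> vertices of the next clique do not give the length \<open>card S * n + 1\<close>.\<close>

definition saturated :: "'v \<Rightarrow> 'v \<Rightarrow> 'i set \<Rightarrow> nat \<Rightarrow> 'v list \<Rightarrow> bool" where
  "saturated b a S d xs \<longleftrightarrow> path_between E (\<Union>(C ` S)) b a xs \<and> length xs = card S * n - d \<and>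
    (\<forall>i\<in>S. n - 1 \<le> steps_in (C i) xs + card (S \<inter> N i) + d)"

text \<open>Induction on the number of cliques outside \<open>S\<close>; all lengths from
  \<open>l0\<close> to \<open>card S * n\<close> are already realised, and \<open>l0\<close> is 3 in
  both uses. Each new clique adds a block of \<open>n\<close> lengths, for which \<open>xs0\<close>
  and \<open>xs1\<close> are both used.\<close>

lemma saturated_grow:
  assumes "S \<subseteq> I" "S \<noteq> {}" "saturated b a S 0 xs0" "saturated b a S 1 xs1"
    and "\<And>l. l0 \<le> l \<Longrightarrow> l \<le> card S * n \<Longrightarrow> \<exists>xs. path_between E (\<Union>(C ` I)) b a xs \<and> length xs = l"
    and "l0 \<le> l" "l \<le> card I * n"
  shows "\<exists>xs. path_between E (\<Union>(C ` I)) b a xs \<and> length xs = l"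
  using assms(1-5)
proof (induction "card (I - S)" arbitrary: S xs0 xs1)
  case 0
  have "S = I"
    using 0(1,2) finite_I by auto
  then show ?case
    using 0(6)[of l] assms(6,7) by simp
next
  case (Suc m)
  have "S \<noteq> I"
    using Suc.hyps(2) by auto
  have finS: "finite S"
    using Suc.prems(1) finite_I by (rule finite_subset)
  have card_pos: "1 \<le> card S"
    using finS Suc.prems(2) by (simp add: Suc_leI card_gt_0_iff)
  then have Sn: "n \<le> card S * n" by simp
  obtain i j where i: "i \<in> S" and j: "j \<in> N i" "j \<notin> S"
    using connected[OF Suc.prems(1,2)] \<open>S \<noteq> I\<close> by (meson subsetI)
  note ext = extend_path[OF Suc.prems(1) i j, where b = b and a = a]
  let ?S = "insert j S"
  have card': "card ?S * n = card S * n + n"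
    using j finS by simp
  have sub: "?S \<subseteq> I"
    using Suc.prems(1) i j N_subset by auto
  have ext0: "\<exists>zs. path_between E (\<Union>(C ` ?S)) b a zs \<and> length zs = card S * n + t \<and>
         t - 1 \<le> steps_in (C j) zs \<and>
         (\<forall>i\<in>S. n - 1 \<le> steps_in (C i) zs + card (?S \<inter> N i))" if "2 \<le> t" "t \<le> n" for t
    using ext[of xs0 0 t] Suc.prems(3) that by (simp add: saturated_def)
  \<comment> \<open>Both new paths extend \<open>xs0\<close>: a detour through \<open>n - d\<close>
    vertices of \<open>C j\<close> puts the deficit into the new clique, while the old ones keep
    their counts without \<open>d\<close>.\<close>
  have grown: "\<exists>ys. saturated b a ?S d ys" if "d \<le> 1" for d
  proof -
    obtain zs where zs: "path_between E (\<Union>(C ` ?S)) b a zs" "length zs = card S * n + (n - d)"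
      "n - d - 1 \<le> steps_in (C j) zs" "\<forall>i\<in>S. n - 1 \<le> steps_in (C i) zs + card (?S \<inter> N i)"
    proof -
      have "2 \<le> n - d" "n - d \<le> n"
        using n_ge \<open>d \<le> 1\<close> by linarith+
      then show thesis
        using ext0[of "n - d"] that by blast
    qed
    have "n - 1 \<le> steps_in (C i) zs + card (?S \<inter> N i) + d" if "i \<in> ?S" for i
    proof (cases "i = j")
      case True
      then show ?thesis using zs(3) by simp
    next
      case False
      then show ?thesis using zs(4) that by (simp add: trans_le_add1)
    qed
    then have "saturated b a ?S d zs"
      using zs(1,2) card' n_ge \<open>d \<le> 1\<close> by (simp add: saturated_def)
    then show ?thesis by blast
  qed
  obtain ys0 ys1 where ys: "saturated b a ?S 0 ys0" "saturated b a ?S 1 ys1"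
    using grown[of 0] grown[of 1] by auto
  have mono: "path_between E (\<Union>(C ` ?S)) b a zs \<Longrightarrow> path_between E (\<Union>(C ` I)) b a zs" for zs
    by (erule path_between_mono) (use sub in auto)
  have all: "\<exists>xs. path_between E (\<Union>(C ` I)) b a xs \<and> length xs = l"
    if l: "l0 \<le> l" "l \<le> card ?S * n" for l
  proof -
    \<comment> \<open>In the second case \<open>xs1\<close>, with \<open>card S * n - 1\<close>
      vertices, takes a detour through 2 vertices; in the third \<open>xs0\<close> takes one through
      \<open>l - card S * n\<close> vertices.\<close>
    consider "l \<le> card S * n" | "l = card S * n + 1" | "card S * n + 2 \<le> l"
      by linarith
    then show ?thesis
    proof cases
      case 1
      then show ?thesis using Suc.prems(5)[of l] l by simp
    next
      case 2
      have "length xs1 + 2 = l"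
        using 2 Suc.prems(4) Sn n_ge by (simp add: saturated_def)
      moreover have "\<exists>zs. path_between E (\<Union>(C ` ?S)) b a zs \<and> length zs = length xs1 + 2"
        using ext[of xs1 1 2] Suc.prems(4) n_ge by (auto simp: saturated_def)
      ultimately show ?thesis
        using mono by auto
    next
      case 3
      then have "2 \<le> l - card S * n" "l - card S * n \<le> n" "card S * n + (l - card S * n) = l"
        using l card' by linarith+
      then have "\<exists>zs. path_between E (\<Union>(C ` ?S)) b a zs \<and> length zs = l"
        using ext0[of "l - card S * n"] by auto
      then show ?thesis
        using mono by auto
    qed
  qed
  have "I - S = insert j (I - ?S)"
    using j sub by auto
  moreover have "card (insert j (I - ?S)) = Suc (card (I - ?S))"
    using finite_I by simp
  ultimately have "m = card (I - ?S)"
    using Suc.hyps(2) by (metis Suc_inject)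
  then show ?case
    using Suc.hyps(1)[OF _ sub _ ys all] by simp
qed

lemma saturated_clique:
  assumes "i \<in> I" "path_between E (C i) b a xs" "length xs = n - d"
  shows "saturated b a {i} d xs"
  using assms steps_in_subset[of xs "C i"] by (simp add: saturated_def path_between_def)

text \<open>Each clique is traversed in one stretch, so the counts hold before any absorbed
  neighbour is added; \<open>i\<close> and \<open>j\<close> may be any two distinct cliques.\<close>

lemma saturated_two_cliques:
  assumes "i \<in> I" "j \<in> I" "i \<noteq> j" "path_between E (C i) b b' xs" "path_between E (C j) a' a ys"
    "E b' a'" "length xs = n - d" "length ys = n" "d \<le> 1"
  shows "saturated b a {i, j} d (xs @ ys)"
proof -
  have "path_between E (C i \<union> C j) b a (xs @ ys)"
    using assms disjoint_C by (intro path_between_append)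
  moreover have "n - 1 \<le> steps_in (C i) (xs @ ys) + d"
    using steps_in_le_append(2)[of "C i" xs ys] steps_in_subset[of xs "C i"] assms
    by (simp add: path_between_def)
  moreover have "n - 1 \<le> steps_in (C j) (xs @ ys)"
    using steps_in_le_append(1)[of "C j" ys xs] steps_in_subset[of ys "C j"] assms
    by (simp add: path_between_def)
  ultimately show ?thesis
    using assms n_ge by (auto simp: saturated_def)
qed

text \<open>A path from \<open>b\<close> to \<open>a\<close> on \<open>l\<close> vertices stands for
  a cycle of length \<open>l\<close> through the edge \<open>ab\<close>. Growth starts from the one
  or two cliques that contain \<open>a\<close> and \<open>b\<close>.\<close>

lemma path_of_length:
  assumes ab: "a \<in> \<Union>(C ` I)" "b \<in> \<Union>(C ` I)" "E a b" "a \<noteq> b"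
    and triangle: "\<exists>c\<in>\<Union>(C ` I). E a c \<and> E b c \<and> c \<noteq> a \<and> c \<noteq> b"
    and across: "\<And>i j. i \<in> I \<Longrightarrow> j \<in> I \<Longrightarrow> i \<noteq> j \<Longrightarrow> a \<in> C i \<Longrightarrow> b \<in> C j \<Longrightarrow>
      \<exists>a'\<in>C i. \<exists>b'\<in>C j. a' \<noteq> a \<and> b' \<noteq> b \<and> E a' b'"
    and l: "3 \<le> l" "l \<le> card I * n"
  shows "\<exists>xs. path_between E (\<Union>(C ` I)) b a xs \<and> length xs = l"
proof -
  obtain i j where ij: "i \<in> I" "j \<in> I" "a \<in> C i" "b \<in> C j"
    using ab by auto
  show ?thesis
  proof (cases "i = j")
    case True
    then have path: "\<exists>xs. path_between E (C i) b a xs \<and> length xs = t" if "2 \<le> t" "t \<le> n" for t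
      using clique_path[of i b a t] ij ab(4) that by auto
    obtain xs0 where "saturated b a {i} 0 xs0"
      using path[of n] n_ge saturated_clique[OF ij(1), of b a _ 0] by auto
    moreover obtain xs1 where "saturated b a {i} 1 xs1"
    proof -
      have "2 \<le> n - 1" "n - 1 \<le> n"
        using n_ge by linarith+
      then show thesis
        using path[of "n - 1"] that saturated_clique[OF ij(1), of b a _ 1] by blast
    qed
    moreover have "\<exists>xs. path_between E (\<Union>(C ` I)) b a xs \<and> length xs = l"
      if "3 \<le> l" "l \<le> card {i} * n" for l
      using path[of l] that ij path_between_mono[of E "C i" b a _ "\<Union>(C ` I)"] by fastforce
    ultimately show ?thesis
      by (rule saturated_grow[of "{i}", rotated 2]) (use ij(1) l in auto)
  next
    case False
    \<comment> \<open>A second edge between the two cliques, disjoint from \<open>ab\<close>, joins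
      a stretch from \<open>b\<close> to \<open>b'\<close> to one from \<open>a'\<close> to
      \<open>a\<close>.\<close>
    obtain a' b' where a'b': "a' \<in> C i" "b' \<in> C j" "a' \<noteq> a" "b' \<noteq> b" "E b' a'"
      using across[OF ij(1,2) False ij(3,4)] sym by blast
    have path: "\<exists>xs ys. path_between E (C j) b b' xs \<and> length xs = s \<and>
        path_between E (C i) a' a ys \<and> length ys = t"
      if "2 \<le> t" "t \<le> n" "2 \<le> s" "s \<le> n" for s t
      using clique_path[of i a' a t] clique_path[of j b b' s] ij a'b' that by auto
    obtain xs0 where "saturated b a {j, i} 0 xs0"
      using path[of n n] n_ge saturated_two_cliques[of j i b b' _ a' a _ 0] ij False a'b' by auto
    moreover obtain xs1 where "saturated b a {j, i} 1 xs1"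
    proof -
      have "2 \<le> n - 1" "n - 1 \<le> n" "2 \<le> n"
        using n_ge by linarith+
      then obtain xs ys where "path_between E (C j) b b' xs" "length xs = n - 1"
        "path_between E (C i) a' a ys" "length ys = n"
        using path[of n "n - 1"] by blast
      then show thesis
        using that[of "xs @ ys"] saturated_two_cliques[of j i b b' xs a' a ys 1] ij False a'b' by simp
    qed
    moreover have "\<exists>xs. path_between E (\<Union>(C ` I)) b a xs \<and> length xs = l"
      if l: "3 \<le> l" "l \<le> card {j, i} * n" for l
    proof (cases "l = 3")
      case True
      \<comment> \<open>Two stretches of at least 2 vertices each have at least 4 together, so
        length 3 takes the common neighbour.\<close>
      obtain c where c: "c \<in> \<Union>(C ` I)" "E a c" "E b c" "c \<noteq> a" "c \<noteq> b"
        using triangle by blast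
      then have "path_between E (\<Union>(C ` I)) b a [b, c, a]"
        using ab sym by (auto simp: path_between_def)
      then show ?thesis
        using True by (intro exI[of _ "[b, c, a]"]) auto
    next
      case ne: False
      \<comment> \<open>The stretch in \<open>C j\<close> is lengthened first, with
        \<open>t = 2\<close>; once it is full, the one in \<open>C i\<close> grows.\<close>
      obtain s t where st: "2 \<le> s" "s \<le> n" "2 \<le> t" "t \<le> n" "s + t = l"
      proof (cases "l \<le> n + 2")
        case True
        then show ?thesis using that[of "l - 2" 2] ne l n_ge by simp
      next
        case len: False
        then show ?thesis using that[of n "l - n"] l n_ge False by simp
      qed
      then obtain xs ys where "path_between E (C j) b b' xs" "length xs = s"
        "path_between E (C i) a' a ys" "length ys = t"
        using path by blast
      then have "path_between E (C j \<union> C i) b a (xs @ ys)" "length (xs @ ys) = l"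
        using path_between_append a'b' disjoint_C[of j i] ij False st by fastforce+
      then show ?thesis
        using path_between_mono[of E "C j \<union> C i" b a _ "\<Union>(C ` I)"] ij by blast
    qed
    ultimately show ?thesis
      by (rule saturated_grow[of "{j, i}", rotated 2]) (use ij(1,2) l in auto)
  qed
qed

end

section \<open>Closing a path to a directed cycle\<close>

lemma walk_of_path:
  assumes "successively (\<lambda>x y. (x, y) \<in> A) xs" "xs \<noteq> []"
  shows "pcas (hd xs) (zip xs (tl xs @ [z])) z"
    and "pawalk_verts (hd xs) (zip xs (tl xs @ [z])) = xs @ [z]"
    and "set (zip xs (tl xs @ [z])) \<subseteq> insert (last xs, z) A"
    and "(last xs, z) \<in> set (zip xs (tl xs @ [z]))"
  \<comment> \<open>The end \<open>z\<close> stays fixed while the head of \<open>xs\<close>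
    changes, so the two are identified only after the induction.\<close>
  using assms by (induction xs rule: induct_list012) auto

text \<open>The closed walk runs along \<open>xs\<close> and returns by the arc
  \<open>(u, v)\<close> itself, so it has as many arcs as \<open>xs\<close> has vertices.\<close>

lemma edge_on_cycle_if_path:
  assumes path: "path_between (\<lambda>x y. (x, y) \<in> parcs G) (pverts G) v u xs"
    and arc: "(u, v) \<in> parcs G"
  shows "edge_on_cycle_of_length G u v (length xs)"
proof -
  have xs: "xs \<noteq> []" "distinct xs" "set xs \<subseteq> pverts G" "hd xs = v" "last xs = u"
    and succ: "successively (\<lambda>x y. (x, y) \<in> parcs G) xs"
    using path by (auto simp: path_between_def)
  note walk = walk_of_path[OF succ xs(1), of v, unfolded xs(4,5)]
  let ?p = "zip xs (tl xs @ [v])"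
  have "v \<in> pverts G"
    using xs hd_in_set by blast
  \<comment> \<open>The predicate \<open>cycle\<close> drops the first vertex of the walk, since it
    recurs at the end.\<close>
  moreover have "distinct (tl (xs @ [v]))"
    using xs by (cases xs) auto
  moreover have "set ?p \<subseteq> parcs G"
    using walk(3) arc by blast
  moreover have len: "length ?p = length xs"
    using xs(1) by simp
  moreover have "?p \<noteq> []"
    using xs(1) len by (metis length_0_conv)
  ultimately have "pre_digraph.cycle (with_proj G) ?p"
    using walk(1,2) unfolding pre_digraph.cycle_def pre_digraph.awalk_def
      cas_with_proj_eq awalk_verts_with_proj_eq with_proj_simps by metis
  then show ?thesis
    using walk(4) len unfolding edge_on_cycle_of_length_def by blast
qed

section \<open>Rotations of values\<close>

text \<open>Addition of \<open>j\<close> modulo \<open>n\<close>, with residues represented in \<open>{1..n}\<close>.\<close>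

definition rot :: "nat \<Rightarrow> nat \<Rightarrow> nat \<Rightarrow> nat" where
  "rot n j v = (if (v + j) mod n = 0 then n else (v + j) mod n)"

lemma rot_mod: "rot n j v mod n = (v + j) mod n"
  by (simp add: rot_def)

lemma rot_eq_iff: "rot n i v = rot n j w \<longleftrightarrow> (v + i) mod n = (w + j) mod n"
proof
  show "(v + i) mod n = (w + j) mod n" if "rot n i v = rot n j w"
    using that by (metis rot_mod)
qed (simp add: rot_def)

lemma rot_mem: "0 < n \<Longrightarrow> rot n j v \<in> {1..n}"
  by (simp add: rot_def less_imp_le Suc_le_eq)

lemma rot_rot: "rot n i (rot n j v) = rot n (i + j) v"
proof -
  have "(rot n j v + i) mod n = (rot n j v mod n + i) mod n"
    by (simp only: mod_add_left_eq)
  also have "\<dots> = (v + (i + j)) mod n"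
    unfolding rot_mod mod_add_left_eq by (simp only: ac_simps)
  finally show ?thesis
    unfolding rot_eq_iff .
qed

lemma mod_add_cancel: "(v + i) mod n = (w + i) mod n \<longleftrightarrow> v mod n = w mod (n::nat)"
  using cong_add_rcancel_nat[of v i w n] unfolding cong_def .

text \<open>The right-hand side is free of \<open>v\<close>: rotations that agree at one value agree
  at all. This makes every rotation class a clique.\<close>

lemma rot_same_iff: "rot n i v = rot n j v \<longleftrightarrow> i mod n = j mod n"
  unfolding rot_eq_iff add.commute[of v] mod_add_cancel ..

lemma rot_full: "v \<in> {1..n} \<Longrightarrow> rot n n v = v"
  by (cases "v = n") (auto simp: rot_def)

lemma inj_on_rot: "inj_on (rot n j) {1..n}"
proof (rule inj_onI)
  fix v w assume vw: "v \<in> {1..n}" "w \<in> {1..n}" and "rot n j v = rot n j w"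
  \<comment> \<open>The shift \<open>j\<close> is replaced by \<open>n\<close>, which fixes
    \<open>{1..n}\<close> pointwise.\<close>
  then have "rot n n v = rot n n w"
    by (simp only: rot_eq_iff mod_add_cancel)
  then show "v = w"
    using vw by (simp only: rot_full)
qed

lemma add_mod_neq: "0 < d \<Longrightarrow> d < n \<Longrightarrow> (x + d) mod n \<noteq> x mod (n::nat)"
  using cong_add_lcancel_0_nat[of x d n] by (auto simp: cong_def)

lemma map_in_arrangements:
  "a \<in> arrangements n k \<Longrightarrow> inj_on f {1..n} \<Longrightarrow> f ` {1..n} \<subseteq> {1..n} \<Longrightarrow> map f a \<in> arrangements n k"
  by (auto simp: arrangements_def distinct_map intro: inj_on_subset)

lemma map_rot_in_arrangements:
  "a \<in> arrangements n k \<Longrightarrow> 0 < n \<Longrightarrow> map (rot n j) a \<in> arrangements n k"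
  using rot_mem by (intro map_in_arrangements inj_on_rot) auto

lemma map_transpose_in_arrangements:
  "a \<in> arrangements n k \<Longrightarrow> u \<in> {1..n} \<Longrightarrow> v \<in> {1..n} \<Longrightarrow>
    map (transpose u v) a \<in> arrangements n k"
  by (intro map_in_arrangements) (auto simp: transpose_def)

lemma nth_arrangements_mem: "a \<in> arrangements n k \<Longrightarrow> i < k \<Longrightarrow> a ! i \<in> {1..n}"
  unfolding arrangements_def using nth_mem[of i a] by blast

lemma nth_arrangements_eq_iff:
  "a \<in> arrangements n k \<Longrightarrow> i < k \<Longrightarrow> j < k \<Longrightarrow> a ! i = a ! j \<longleftrightarrow> i = j"
  by (auto simp: arrangements_def nth_eq_iff_index_eq)

lemma length_arrangements: "a \<in> arrangements n k \<Longrightarrow> length a = k"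
  by (simp add: arrangements_def)

section \<open>Common neighbours\<close>

definition conflicts :: "'a list \<Rightarrow> 'a list \<Rightarrow> 'a list \<Rightarrow> nat set" where
  "conflicts a b c = {i. i < length c \<and> (c ! i = a ! i \<or> c ! i = b ! i)}"

text \<open>Exchanging the values \<open>a ! i\<close> and \<open>v\<close> in \<open>c\<close>
  cures coordinate \<open>i\<close>. A new conflict could arise only where \<open>c\<close> had
  \<open>v\<close> and now has \<open>a ! i\<close>, that is, at \<open>i\<close> or where
  \<open>b\<close> has \<open>a ! i\<close>; the choice of \<open>v\<close> excludes both. Only
  three values are forbidden, fewer than \<open>n\<close>.\<close>

lemma reduce_conflicts:
  assumes a: "a \<in> arrangements n k" and b: "b \<in> arrangements n k" and c: "c \<in> arrangements n k"
    and n: "4 \<le> n" and i: "i < k" "c ! i = a ! i"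
  shows "\<exists>c'\<in>arrangements n k. conflicts a b c' \<subset> conflicts a b c"
proof -
  \<comment> \<open>If \<open>b\<close> does not contain \<open>a ! i\<close>, then \<open>j\<close>
    is arbitrary and avoiding \<open>c ! j\<close> merely forbids one more value.\<close>
  define j where "j = (SOME j. j < k \<and> b ! j = a ! i)"
  have j: "j' = j" if "j' < k" "b ! j' = a ! i" for j'
  proof -
    have "j < k \<and> b ! j = a ! i"
      unfolding j_def by (rule someI[of _ j']) (use that in simp)
    then show ?thesis
      using that nth_arrangements_eq_iff[OF b] by metis
  qed
  have "card {a ! i, b ! i, c ! j} \<le> 3"
    by (simp add: card_insert_if)
  then have "card {a ! i, b ! i, c ! j} < card {1..n}"
    using n by simp
  then have "\<not> {1..n} \<subseteq> {a ! i, b ! i, c ! j}"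
    using card_mono[of "{a ! i, b ! i, c ! j}" "{1..n}"] by auto
  then obtain v where v: "v \<in> {1..n}" "v \<noteq> a ! i" "v \<noteq> b ! i" "v \<noteq> c ! j"
    by blast
  let ?c = "map (transpose (a ! i) v) c"
  have len: "length c = k"
    using c by (rule length_arrangements)
  have "?c \<in> arrangements n k"
    using c v nth_arrangements_mem[OF a i(1)] by (intro map_transpose_in_arrangements)
  moreover have "conflicts a b ?c \<subseteq> conflicts a b c"
  proof
    fix m assume "m \<in> conflicts a b ?c"
    then have m: "m < k" "transpose (a ! i) v (c ! m) \<in> {a ! m, b ! m}"
      using len by (auto simp: conflicts_def)
    have "c ! m \<noteq> a ! i"
    proof
      assume eq: "c ! m = a ! i"
      then have "m = i"
        using nth_arrangements_eq_iff[OF c m(1) i(1)] i by simp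
      then show False
        using m v eq by simp
    qed
    moreover have "c ! m \<noteq> v"
    proof
      assume eq: "c ! m = v"
      then have "a ! i \<in> {a ! m, b ! m}"
        using m by simp
      then have "m = i \<or> m = j"
        using j[OF m(1)] nth_arrangements_eq_iff[OF a i(1) m(1)] by auto
      then show False
        using eq i v by auto
    qed
    ultimately show "m \<in> conflicts a b c"
      using m len by (auto simp: conflicts_def)
  qed
  moreover have "i \<in> conflicts a b c" "i \<notin> conflicts a b ?c"
    using i v len by (auto simp: conflicts_def)
  ultimately show ?thesis
    by blast
qed

lemma common_neighbour:
  assumes a: "a \<in> arrangements n k" and b: "b \<in> arrangements n k" and n: "4 \<le> n"
  shows "\<exists>c\<in>arrangements n k. \<forall>i<k. c ! i \<noteq> a ! i \<and> c ! i \<noteq> b ! i"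
proof -
  have "\<exists>c'\<in>arrangements n k. conflicts a b c' = {}" if "c \<in> arrangements n k" for c
    using that
  proof (induction "card (conflicts a b c)" arbitrary: c rule: less_induct)
    case less
    show ?case
    proof (cases "conflicts a b c = {}")
      case True
      then show ?thesis using less.prems by blast
    next
      case False
      then obtain i where i: "i < k" "c ! i = a ! i \<or> c ! i = b ! i"
        using length_arrangements[OF less.prems] by (auto simp: conflicts_def)
      have commute: "conflicts b a = conflicts a b"
        unfolding conflicts_def by blast
      obtain c' where c': "c' \<in> arrangements n k" "conflicts a b c' \<subset> conflicts a b c"
        using i(2)
      proof
        assume "c ! i = a ! i"
        then show thesis
          using reduce_conflicts[OF a b less.prems n i(1)] that by blast
      next
        assume "c ! i = b ! i"
        then show thesis
          using reduce_conflicts[OF b a less.prems n i(1)] that unfolding commute by blast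
      qed
      have "finite (conflicts a b c)"
        by (simp add: conflicts_def)
      then have "card (conflicts a b c') < card (conflicts a b c)"
        using c'(2) by (rule psubset_card_mono)
      then show ?thesis
        using c'(1) by (rule less.hyps)
    qed
  qed
  \<comment> \<open>The removal of conflicts may start from any tuple; \<open>a\<close> itself is at
    hand.\<close>
  then obtain c where "c \<in> arrangements n k" "conflicts a b c = {}"
    using a by blast
  then show ?thesis
    using length_arrangements by (intro bexI[of _ c]) (auto simp: conflicts_def)
qed

section \<open>The partition into rotation classes\<close>

text \<open>The shift ranges over all naturals, so further rotation stays in the class without
  reducing modulo \<open>n\<close>.\<close>

definition rotation_class :: "nat \<Rightarrow> nat list \<Rightarrow> nat list set" where
  "rotation_class n r = range (\<lambda>j. map (rot n j) r)"

definition rotation_reps :: "nat \<Rightarrow> nat \<Rightarrow> nat list set" where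
  "rotation_reps n k = {r \<in> arrangements n k. r ! 0 = n}"

text \<open>The largest swap exchanges \<open>n - 2\<close> and \<open>n - 1\<close>, so the leading
  \<open>n\<close> of a representative stays fixed.\<close>

definition adjacent_swaps :: "nat \<Rightarrow> nat list \<Rightarrow> nat list set" where
  "adjacent_swaps n r = (\<lambda>v. map (transpose v (Suc v)) r) ` {1..n - 2}"

lemma rotation_class_subset:
  "r \<in> rotation_reps n k \<Longrightarrow> 0 < n \<Longrightarrow> rotation_class n r \<subseteq> arrangements n k"
  by (auto simp: rotation_class_def rotation_reps_def intro: map_rot_in_arrangements)

lemma rotation_class_cover:
  assumes a: "a \<in> arrangements n k" and k: "0 < k"
  shows "\<exists>r\<in>rotation_reps n k. a \<in> rotation_class n r"
proof -
  \<comment> \<open>This shift takes the first entry to \<open>n\<close>; the shift by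
    \<open>a ! 0\<close> undoes it.\<close>
  let ?r = "map (rot n (n - a ! 0)) a"
  have a0: "a ! 0 \<in> {1..n}"
    using nth_arrangements_mem[OF a k] .
  then have n: "0 < n" by auto
  have "?r ! 0 = n"
    using a0 n k length_arrangements[OF a] by (simp add: rot_def)
  moreover have "map (rot n (a ! 0)) ?r = a"
  proof -
    have "rot n (a ! 0) (rot n (n - a ! 0) v) = v" if "v \<in> set a" for v
      using a0 that a n by (auto simp: rot_rot rot_full arrangements_def)
    then show ?thesis
      by (simp add: map_idI)
  qed
  ultimately show ?thesis
    using map_rot_in_arrangements[OF a n] unfolding rotation_reps_def rotation_class_def
    by (metis (mono_tags, lifting) mem_Collect_eq rangeI)
qed

lemma card_rotation_class:
  assumes r: "r \<in> rotation_reps n k" and n: "0 < n" and k: "0 < k"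
  shows "card (rotation_class n r) = n"
proof -
  have "inj_on (\<lambda>j. map (rot n j) r) {..<n}"
  proof (rule inj_onI)
    fix i j assume ij: "i \<in> {..<n}" "j \<in> {..<n}" "map (rot n i) r = map (rot n j) r"
    have "r \<noteq> []"
      using r k by (auto simp: rotation_reps_def arrangements_def)
    then have "rot n i (hd r) = rot n j (hd r)"
      using ij(3) by (cases r) auto
    then show "i = j"
      using ij(1,2) by (simp add: rot_same_iff)
  qed
  moreover have "rotation_class n r = (\<lambda>j. map (rot n j) r) ` {..<n}"
  proof -
    have "map (rot n j) r = map (rot n (j mod n)) r" for j
      using rot_same_iff[of n j _ "j mod n"] by simp
    moreover have "j mod n \<in> {..<n}" for j
      using n by simp
    ultimately show ?thesis
      unfolding rotation_class_def by blast
  qed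
  ultimately show ?thesis
    by (simp add: card_image)
qed

text \<open>Both representatives start with \<open>n\<close>, so the first entry of \<open>x\<close>
  determines the shift modulo \<open>n\<close>; injectivity of the rotation gives the rest.\<close>

lemma disjoint_rotation_class:
  assumes r: "r \<in> rotation_reps n k" and s: "s \<in> rotation_reps n k" and k: "0 < k"
    and x: "x \<in> rotation_class n r" "x \<in> rotation_class n s"
  shows "r = s"
proof -
  obtain i j where ij: "x = map (rot n i) r" "x = map (rot n j) s"
    using x unfolding rotation_class_def by blast
  have rs: "r \<in> arrangements n k" "s \<in> arrangements n k" "r ! 0 = n" "s ! 0 = n"
    using r s by (auto simp: rotation_reps_def)
  have eq: "rot n i (r ! m) = rot n j (s ! m)" if "m < k" for m
    using ij that rs by (metis length_arrangements nth_map)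
  from eq[OF k] have "i mod n = j mod n"
    using rs by (simp add: rot_same_iff)
  then have "rot n j (r ! m) = rot n j (s ! m)" if "m < k" for m
    using eq[OF that] rot_same_iff by metis
  then have "r ! m = s ! m" if "m < k" for m
    using inj_onD[OF inj_on_rot] that rs nth_arrangements_mem by metis
  then show ?thesis
    using rs length_arrangements by (metis nth_equalityI)
qed

section \<open>Connectivity of the classes under adjacent swaps\<close>

lemma adjacent_swaps_subset:
  assumes "r \<in> rotation_reps n k" "0 < k"
  shows "adjacent_swaps n r \<subseteq> rotation_reps n k"
proof -
  have "map (transpose v (Suc v)) r \<in> rotation_reps n k" if "v \<in> {1..n - 2}" for v
    using that assms map_transpose_in_arrangements[of r n k v "Suc v"]
    by (auto simp: rotation_reps_def length_arrangements)
  then show ?thesis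
    by (auto simp: adjacent_swaps_def)
qed

text \<open>The transposition of \<open>u\<close> and \<open>w + 1\<close> is the one of
  \<open>u\<close> and \<open>w\<close> conjugated by the adjacent swap of \<open>w\<close> and
  \<open>w + 1\<close>.\<close>

lemma transpose_closed:
  assumes closed: "\<And>r. r \<in> S \<Longrightarrow> adjacent_swaps n r \<subseteq> S"
    and r: "r \<in> S" and uw: "1 \<le> u" "u < w" "w < n"
  shows "map (transpose u w) r \<in> S"
  using uw(2,3) r
proof (induction w arbitrary: r)
  case (Suc w)
  have adj: "map (transpose w (Suc w)) s \<in> S" if "s \<in> S" for s
  proof -
    have "w \<in> {1..n - 2}"
      using Suc.prems uw(1) by auto
    then show ?thesis
      using closed[OF that] unfolding adjacent_swaps_def by blast
  qed
  show ?case
  proof (cases "u = w")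
    case True
    then show ?thesis using adj Suc.prems by simp
  next
    case False
    then have "map (transpose w (Suc w)) (map (transpose u w) (map (transpose w (Suc w)) r)) \<in> S"
      using Suc adj by (simp del: map_map)
    moreover have "transpose w (Suc w) \<circ> (transpose u w \<circ> transpose w (Suc w)) = transpose u (Suc w)"
      using transpose_comp_triple[of "Suc w" u w] Suc.prems False
      by (simp add: transpose_commute comp_assoc)
    ultimately show ?thesis by simp
  qed
qed simp

text \<open>A member of \<open>S\<close> is turned into \<open>s\<close> coordinate by coordinate,
  exchanging the values \<open>r ! m\<close> and \<open>s ! m\<close> at coordinate
  \<open>m\<close>.\<close>

lemma adjacent_swaps_connected:
  assumes S: "S \<subseteq> rotation_reps n k" "S \<noteq> {}" and closed: "\<And>r. r \<in> S \<Longrightarrow> adjacent_swaps n r \<subseteq> S"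
  shows "S = rotation_reps n k"
proof (rule antisym[OF S(1)], rule subsetI)
  fix s assume s: "s \<in> rotation_reps n k"
  then have s': "s \<in> arrangements n k" "s ! 0 = n"
    by (auto simp: rotation_reps_def)
  have "\<exists>r\<in>S. \<forall>i<m. r ! i = s ! i" if "m \<le> k" for m
    using that
  proof (induction m)
    case 0
    then show ?case using S by auto
  next
    case (Suc m)
    then obtain r where r: "r \<in> S" and agree: "\<forall>i<m. r ! i = s ! i"
      by auto
    have r': "r \<in> arrangements n k" "r ! 0 = n"
      using r S by (auto simp: rotation_reps_def)
    have m: "m < k" and "0 < k"
      using Suc by auto
    show ?case
    proof (cases "r ! m = s ! m")
      case True
      then show ?thesis using agree r by (auto simp: less_Suc_eq)
    next
      case False
      then have "m \<noteq> 0"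
        using r' s' by metis
      \<comment> \<open>The value \<open>n\<close> sits at coordinate 0 in both tuples, so the
        exchange involves only values below \<open>n\<close>, as \<open>transpose_closed\<close>
        demands.\<close>
      then have "r ! m \<noteq> n" "s ! m \<noteq> n"
        using nth_arrangements_eq_iff[OF r'(1) m \<open>0 < k\<close>] nth_arrangements_eq_iff[OF s'(1) m \<open>0 < k\<close>] r' s'
        by auto
      then have range: "1 \<le> r ! m" "r ! m < n" "1 \<le> s ! m" "s ! m < n"
        using nth_arrangements_mem[OF r'(1) m] nth_arrangements_mem[OF s'(1) m] by auto
      let ?t = "map (transpose (r ! m) (s ! m)) r"
      have "?t \<in> S"
        using transpose_closed[OF closed r, of "r ! m" "s ! m"]
          transpose_closed[OF closed r, of "s ! m" "r ! m"] range False
        by (cases "r ! m < s ! m") (auto simp: transpose_commute)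
      moreover have "?t ! i = s ! i" if "i < Suc m" for i
      proof (cases "i = m")
        case True
        then show ?thesis using m length_arrangements[OF r'(1)] by simp
      next
        case False
        then have i: "i < m" "i < k"
          using that m by auto
        \<comment> \<open>Coordinates already matched contain neither exchanged value, since
          \<open>r\<close> and \<open>s\<close> have distinct entries.\<close>
        then have "r ! i \<noteq> r ! m" "r ! i \<noteq> s ! m"
          using agree nth_arrangements_eq_iff[OF r'(1) i(2) m] nth_arrangements_eq_iff[OF s'(1) i(2) m]
          by auto
        then show ?thesis
          using i agree length_arrangements[OF r'(1)] by simp
      qed
      ultimately show ?thesis by blast
    qed
  qed
  then obtain r where r: "r \<in> S" "\<forall>i<k. r ! i = s ! i"
    by blast
  moreover have "length r = k" "length s = k"
    using r s' S length_arrangements by (auto simp: rotation_reps_def)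
  ultimately show "s \<in> S"
    by (metis nth_equalityI)
qed

section \<open>Edges within and between the classes\<close>

abbreviation (input) deranged :: "nat \<Rightarrow> nat \<Rightarrow> nat list \<Rightarrow> nat list \<Rightarrow> bool" where
  "deranged n k a b \<equiv> (a, b) \<in> parcs (tuple_derangement_graph n k)"

lemma deranged_iff:
  "deranged n k a b \<longleftrightarrow> a \<in> arrangements n k \<and> b \<in> arrangements n k \<and> (\<forall>i<k. a ! i \<noteq> b ! i)"
  by (simp add: tuple_derangement_graph_def)

text \<open>The transposition of \<open>v\<close> and \<open>v + 1\<close> moves each value by at most one, so a rotation by two
  afterwards moves each value by 1, 2 or 3, and none of these is 0 modulo \<open>n \<ge> 4\<close>.\<close>

lemma deranged_rot_adjacent_swap:
  assumes n: "4 \<le> n" and r: "r \<in> arrangements n k" and v: "v \<in> {1..n - 2}"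
  shows "deranged n k (map (rot n p) r) (map (rot n (p + 2)) (map (transpose v (Suc v)) r))"
proof -
  have "rot n p x \<noteq> rot n (p + 2) (transpose v (Suc v) x)" for x
  proof -
    consider "x = v" | "x = Suc v" | "x \<noteq> v" "x \<noteq> Suc v" by blast
    then show ?thesis
    proof cases
      case 1
      then show ?thesis
        using add_mod_neq[of 3 n "v + p"] n by (auto simp: rot_eq_iff eval_nat_numeral)
    next
      case 2
      then show ?thesis
        using add_mod_neq[of 1 n "Suc v + p"] n by (auto simp: rot_eq_iff eval_nat_numeral)
    next
      case 3
      then show ?thesis
        using add_mod_neq[of 2 n "x + p"] n by (auto simp: rot_eq_iff eval_nat_numeral)
    qed
  qed
  moreover have "map (transpose v (Suc v)) r \<in> arrangements n k"
    using v by (intro map_transpose_in_arrangements r) auto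
  ultimately show ?thesis
    using n r by (auto simp: deranged_iff length_arrangements simp del: map_map
        intro!: map_rot_in_arrangements)
qed

lemma clique_partition_tuple_derangement_graph:
  assumes n: "4 \<le> n" and k: "0 < k"
  shows "clique_partition (deranged n k) (rotation_class n) (rotation_reps n k) (adjacent_swaps n) n"
proof
  have n0: "0 < n" using n by simp
  show "4 \<le> n" by fact
  show "deranged n k y x" if "deranged n k x y" for x y
    using that by (auto simp: deranged_iff)
  show "finite (rotation_reps n k)"
    by (simp add: rotation_reps_def finite_arrangements)
  show "card (rotation_class n r) = n" if "r \<in> rotation_reps n k" for r
    using card_rotation_class[OF that n0 k] .
  show "rotation_class n r \<inter> rotation_class n s = {}"
    if "r \<in> rotation_reps n k" "s \<in> rotation_reps n k" "r \<noteq> s" for r s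
    using disjoint_rotation_class[OF that(1,2) k] that(3) by blast
  show "adjacent_swaps n r \<subseteq> rotation_reps n k" if "r \<in> rotation_reps n k" for r
    using adjacent_swaps_subset[OF that k] .
  show "card (adjacent_swaps n r) \<le> n - 2" for r
    unfolding adjacent_swaps_def using card_image_le[of "{1..n - 2}"] by simp
  have E: "deranged n k (map (rot n i) r) (map (rot n j) r)"
    if "r \<in> rotation_reps n k" "map (rot n i) r \<noteq> map (rot n j) r" for i j r
  proof -
    have r: "r \<in> arrangements n k"
      using that by (simp add: rotation_reps_def)
    have "rot n i v \<noteq> rot n j v" for v
      using that(2) by (auto simp: rot_same_iff)
    then show ?thesis
      using r n0 by (auto simp: deranged_iff length_arrangements intro: map_rot_in_arrangements)
  qed
  then show "deranged n k x y" if "r \<in> rotation_reps n k" "x \<in> rotation_class n r"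
    "y \<in> rotation_class n r" "x \<noteq> y" for r x y
    using that by (auto simp: rotation_class_def)
  show "\<exists>x'\<in>rotation_class n s. \<exists>y'\<in>rotation_class n s.
      x' \<noteq> y' \<and> deranged n k x x' \<and> deranged n k y' y"
    if r: "r \<in> rotation_reps n k" and s: "s \<in> adjacent_swaps n r" and xy: "x \<in> rotation_class n r"
      "y \<in> rotation_class n r" "x \<noteq> y" for r s x y
  proof -
    obtain p q where pq: "x = map (rot n p) r" "y = map (rot n q) r"
      using xy by (auto simp: rotation_class_def)
    obtain v where v: "v \<in> {1..n - 2}" "s = map (transpose v (Suc v)) r"
      using s by (auto simp: adjacent_swaps_def)
    have r': "r \<in> arrangements n k"
      using r by (simp add: rotation_reps_def)
    \<comment> \<open>Both ends get the same additional shift 2, which cancels, so distinct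
      \<open>x\<close> and \<open>y\<close> have distinct partners.\<close>
    have "map (rot n (p + 2)) s \<noteq> map (rot n (q + 2)) s"
    proof
      assume eq: "map (rot n (p + 2)) s = map (rot n (q + 2)) s"
      have "s \<noteq> []"
        using k length_arrangements[OF r'] v by auto
      then have "rot n (p + 2) (hd s) = rot n (q + 2) (hd s)"
        using eq by (cases s) auto
      then have "p mod n = q mod n"
        by (simp only: rot_same_iff mod_add_cancel)
      then show False
        using pq xy(3) by (auto simp: rot_same_iff)
    qed
    moreover have "deranged n k x (map (rot n (p + 2)) s)" "deranged n k (map (rot n (q + 2)) s) y"
      using deranged_rot_adjacent_swap[OF n r' v(1), of p] deranged_rot_adjacent_swap[OF n r' v(1), of q]
        pq v(2) by (auto simp: deranged_iff)
    ultimately show ?thesis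
      unfolding rotation_class_def by blast
  qed
  show "S = rotation_reps n k"
    if "S \<subseteq> rotation_reps n k" "S \<noteq> {}" "\<And>r. r \<in> S \<Longrightarrow> adjacent_swaps n r \<subseteq> S" for S
    using adjacent_swaps_connected[OF that] .
qed

section \<open>Cycles through a given edge of the graph\<close>

lemma rot_one_rotation_class:
  "0 < n \<Longrightarrow> a \<in> rotation_class n r \<Longrightarrow> map (rot n 1) a \<in> rotation_class n r"
  by (auto simp: rotation_class_def rot_rot)

lemma map_rot_one_neq:
  assumes "a \<in> arrangements n k" "0 < k" "1 < n"
  shows "map (rot n 1) a \<noteq> a"
proof
  assume "map (rot n 1) a = a"
  then have "rot n 1 (a ! 0) = a ! 0"
    using assms by (metis length_arrangements nth_map)
  then have "rot n 1 (a ! 0) = rot n n (a ! 0)"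
    using rot_full[OF nth_arrangements_mem[OF assms(1,2)]] by simp
  then show False
    using add_mod_neq[of 1 n "a ! 0"] assms(3) by (simp add: rot_eq_iff)
qed

text \<open>With \<open>j = 1\<close> this yields the second edge between the classes of
  \<open>a\<close> and \<open>b\<close> that \<open>path_of_length\<close> asks for.\<close>

lemma deranged_map_rot:
  assumes "deranged n k a b" "0 < n"
  shows "deranged n k (map (rot n j) a) (map (rot n j) b)"
  using assms inj_onD[OF inj_on_rot] nth_arrangements_mem
  by (auto simp: deranged_iff length_arrangements intro: map_rot_in_arrangements)

lemma deranged_edge_on_cycle:
  assumes n: "4 \<le> n" and k: "0 < k" and ab: "deranged n k a b"
    and l: "3 \<le> l" "l \<le> card (arrangements n k)"
  shows "edge_on_cycle_of_length (tuple_derangement_graph n k) a b l"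
proof -
  interpret clique_partition "deranged n k" "rotation_class n" "rotation_reps n k" "adjacent_swaps n" n
    using n k by (rule clique_partition_tuple_derangement_graph)
  have n0: "0 < n" "1 < n" using n by auto
  have cover: "\<Union>(rotation_class n ` rotation_reps n k) = arrangements n k"
  proof
    show "\<Union>(rotation_class n ` rotation_reps n k) \<subseteq> arrangements n k"
      using rotation_class_subset[OF _ n0(1)] by (rule UN_least)
    show "arrangements n k \<subseteq> \<Union>(rotation_class n ` rotation_reps n k)"
    proof
      fix x assume "x \<in> arrangements n k"
      then show "x \<in> \<Union>(rotation_class n ` rotation_reps n k)"
        using rotation_class_cover k by (auto simp: Bex_def)
    qed
  qed
  \<comment> \<open>The classes are disjoint and of size \<open>n\<close>, which turns the bound on
    \<open>l\<close> into the form used by \<open>path_of_length\<close>.\<close>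
  have "card (\<Union>(rotation_class n ` rotation_reps n k)) = card (rotation_reps n k) * n"
    using finite_I finite_C card_C disjoint_C by (subst card_UN_disjoint) auto
  then have l': "l \<le> card (rotation_reps n k) * n"
    using l cover by simp
  have a: "a \<in> arrangements n k" and b: "b \<in> arrangements n k" and "a \<noteq> b"
    using ab k by (auto simp: deranged_iff)
  obtain c where c: "c \<in> arrangements n k" "\<forall>i<k. c ! i \<noteq> a ! i \<and> c ! i \<noteq> b ! i"
    using common_neighbour[OF a b n] by blast
  have "\<exists>xs. path_between (deranged n k) (\<Union>(rotation_class n ` rotation_reps n k)) b a xs \<and> length xs = l"
  proof (rule path_of_length[OF _ _ ab \<open>a \<noteq> b\<close> _ _ l(1) l'])
    show "\<exists>c\<in>\<Union>(rotation_class n ` rotation_reps n k). deranged n k a c \<and> deranged n k b c \<and> c \<noteq> a \<and> c \<noteq> b"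
      unfolding cover using c a b k by (intro bexI[of _ c]) (auto simp: deranged_iff)
    show "\<exists>a'\<in>rotation_class n i. \<exists>b'\<in>rotation_class n j. a' \<noteq> a \<and> b' \<noteq> b \<and> deranged n k a' b'"
      if "a \<in> rotation_class n i" "b \<in> rotation_class n j" for i j
      using rot_one_rotation_class[OF n0(1)] that map_rot_one_neq[OF a k n0(2)]
        map_rot_one_neq[OF b k n0(2)] deranged_map_rot[OF ab n0(1)] by blast
  qed (use a b cover in auto)
  then obtain xs where "path_between (deranged n k) (arrangements n k) b a xs" "length xs = l"
    unfolding cover by blast
  then show ?thesis
    using edge_on_cycle_if_path[of "tuple_derangement_graph n k" b a xs] ab
    by (simp add: tuple_derangement_graph_def)
qed

text \<open>A single rotation class already has \<open>n\<close> vertices.\<close>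

lemma three_le_card_arrangements:
  assumes "4 \<le> k" "k \<le> n"
  shows "3 \<le> card (arrangements n k)"
proof -
  have "[1..<Suc k] \<in> arrangements n k" and pos: "0 < k" "0 < n"
    using assms by (auto simp: arrangements_def)
  then obtain r where r: "r \<in> rotation_reps n k"
    using rotation_class_cover by blast
  have "n \<le> card (arrangements n k)"
    using card_mono[OF finite_arrangements rotation_class_subset[OF r pos(2)]]
      card_rotation_class[OF r pos(2,1)] by simp
  then show ?thesis
    using assms by simp
qed

theorem theorem1p4:
  fixes n k :: nat
  assumes "4 \<le> k" and "k \<le> n"
  shows "edge_pancyclic (tuple_derangement_graph n k) \<and>
    (\<forall>a b l. (a, b) \<in> parcs (tuple_derangement_graph n k) \<longrightarrow>
      3 \<le> l \<longrightarrow> l \<le> fact n div fact (n - k) \<longrightarrow>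
      edge_on_cycle_of_length (tuple_derangement_graph n k) a b l)"
proof -
  have "pair_graph (tuple_derangement_graph n k)"
    using assms by (intro pair_graph_tuple_derangement_graph) simp
  moreover have "pverts (tuple_derangement_graph n k) = arrangements n k"
    by (simp add: tuple_derangement_graph_def)
  ultimately show ?thesis
    using assms three_le_card_arrangements[OF assms] card_arrangements[OF assms(2)]
    by (auto simp: edge_pancyclic_def intro: deranged_edge_on_cycle)
qed

end
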